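(* Let $X$ be an $\infty$-pseudo-metric space. If $X$ has Asymptotic Property D, then $X$ has Asymptotic Property C.
   Context: An $\infty$-pseudo-metric space is a set $X$ with $d:X\times X\to[0,\infty]$ such that $d(x,x)=0$, $d(x,y)=d(y,x)$, and $d(x,y)\le d(x,z)+d(z,y)$ whenever $d(x,z),d(z,y)<\infty$. $B(x,r)=\{y: d(x,y)<r\}$. Scale-$r$-dimension: for $A\subset X$ and $r>0$, a scale-$r$-chain in $A$ is a finite sequence $x_0,\dots,x_k$ of points of $A$ with $B(x_i,r)\cap B(x_{i+1},r)\neq\emptyset$ for $0\le i<k$ (balls in $X$). The scale-$r$-component of $x\in A$ is the set of points of $A$ that can be joined to $x$ by a scale-$r$-chain in $A$. $A$ is of scale-$r$-dimension $0$ if the supremum of the diameters of its scale-$r$-components is finite (the diameter of $\emptyset$ is $0$). For a real number $t\ge 0$, "$A$ has scale-$r$-dimension at most $t-1$" means $A$ is a union of $\lfloor t\rfloor$ subsets of scale-$r$-dimension $0$ (so $A=\emptyset$ if $\lfloor t\rfloor=0$). APD profile: a finite array of functions $(\alpha_0,\dots,\alpha_k)$ from $[0,\infty)$ to $[0,\infty)$ is an APD profile of $X$ if (1) $\alpha_0$ is constant; (2) each $\alpha_i$ is non-decreasing; (3) for any non-decreasing array $(r_0,\dots,r_k)$ of positive real numbers, $X$ is a union of subsets $X_0,\dots,X_k$ such that each $X_i$ has scale-$r_i$-dimension at most $\alpha_i(r_{i-1})-1$ (for $i=0$ the value of the constant $\alpha_0$ is used). $X$ has Asymptotic Property D if it has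 an APD profile. $X$ has Asymptotic Property C if for each sequence $\{r_i\}_{i\ge1}$ of positive real numbers there are a natural number $n$ and a decomposition $X=\bigcup_{i=1}^n X_i$ such that each $X_i$ is of scale-$r_i$-dimension $0$. *)

theory Defs
  imports "HOL-Library.Extended_Nonnegative_Real"
begin

locale inf_pseudo_metric_space =
  fixes X :: "'a set" and d :: "'a \<Rightarrow> 'a \<Rightarrow> ennreal"
  assumes dist_refl: "x \<in> X \<Longrightarrow> d x x = 0"
    and dist_sym: "\<lbrakk>x \<in> X; y \<in> X\<rbrakk> \<Longrightarrow> d x y = d y x"
    and dist_triangle:
      "\<lbrakk>x \<in> X; y \<in> X; z \<in> X; d x z < \<infinity>; d z y < \<infinity>\<rbrakk> \<Longrightarrow> d x y \<le> d x z + d z y"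

definition pball :: "'a set \<Rightarrow> ('a \<Rightarrow> 'a \<Rightarrow> ennreal) \<Rightarrow> 'a \<Rightarrow> real \<Rightarrow> 'a set" where
  "pball X d x r = {y \<in> X. d x y < ennreal r}"

text \<open>The supremum is taken in \<^typ>\<open>ennreal\<close>, so the diameter of the empty set is 0.\<close>

definition pdiam :: "('a \<Rightarrow> 'a \<Rightarrow> ennreal) \<Rightarrow> 'a set \<Rightarrow> ennreal" where
  "pdiam d C = (SUP x\<in>C. SUP y\<in>C. d x y)"

text \<open>The chain runs in \<open>A\<close>, but the balls are those of the whole space \<open>X\<close>.\<close>

definition scale_chain ::
    "'a set \<Rightarrow> ('a \<Rightarrow> 'a \<Rightarrow> ennreal) \<Rightarrow> real \<Rightarrow> 'a set \<Rightarrow> 'a list \<Rightarrow> bool" where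
  "scale_chain X d r A xs \<longleftrightarrow>
     xs \<noteq> [] \<and> set xs \<subseteq> A \<and>
     (\<forall>i. Suc i < length xs \<longrightarrow> pball X d (xs ! i) r \<inter> pball X d (xs ! Suc i) r \<noteq> {})"

definition scale_component ::
    "'a set \<Rightarrow> ('a \<Rightarrow> 'a \<Rightarrow> ennreal) \<Rightarrow> real \<Rightarrow> 'a set \<Rightarrow> 'a \<Rightarrow> 'a set" where
  "scale_component X d r A x =
     {y \<in> A. \<exists>xs. scale_chain X d r A xs \<and> hd xs = x \<and> last xs = y}"

definition scale_dim_zero ::
    "'a set \<Rightarrow> ('a \<Rightarrow> 'a \<Rightarrow> ennreal) \<Rightarrow> real \<Rightarrow> 'a set \<Rightarrow> bool" where
  "scale_dim_zero X d r A \<longleftrightarrow> (SUP x\<in>A. pdiam d (scale_component X d r A x)) < \<infinity>"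

text \<open>
  \<open>scale_dim_at_most_pred X d r A t\<close> says that \<open>A\<close> has scale-\<open>r\<close>-dimension at most \<open>t - 1\<close>,
  for real \<open>t \<ge> 0\<close>.
\<close>

definition scale_dim_at_most_pred ::
    "'a set \<Rightarrow> ('a \<Rightarrow> 'a \<Rightarrow> ennreal) \<Rightarrow> real \<Rightarrow> 'a set \<Rightarrow> real \<Rightarrow> bool" where
  "scale_dim_at_most_pred X d r A t \<longleftrightarrow>
     (\<exists>F :: nat \<Rightarrow> 'a set.
        A = (\<Union>j<nat \<lfloor>t\<rfloor>. F j) \<and> (\<forall>j<nat \<lfloor>t\<rfloor>. scale_dim_zero X d r (F j)))"

text \<open>
  The array \<open>(\<alpha> 0, \<dots>, \<alpha> k)\<close> is given by \<open>k\<close> and a sequence, of which only the entries with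
  index at most \<open>k\<close>, restricted to \<open>[0, \<infinity>)\<close>, matter. The function \<open>\<alpha> 0\<close> is constant there,
  so \<open>\<alpha> 0 0\<close> is its value.
\<close>

definition APD_profile ::
    "'a set \<Rightarrow> ('a \<Rightarrow> 'a \<Rightarrow> ennreal) \<Rightarrow> nat \<Rightarrow> (nat \<Rightarrow> real \<Rightarrow> real) \<Rightarrow> bool" where
  "APD_profile X d k \<alpha> \<longleftrightarrow>
     (\<forall>i\<le>k. \<forall>s\<ge>0. 0 \<le> \<alpha> i s) \<and>
     (\<exists>c. \<forall>s\<ge>0. \<alpha> 0 s = c) \<and>
     (\<forall>i\<le>k. mono_on {0..} (\<alpha> i)) \<and>
     (\<forall>r :: nat \<Rightarrow> real.
        (\<forall>i\<le>k. 0 < r i) \<and> mono_on {..k} r \<longrightarrow>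
        (\<exists>Y :: nat \<Rightarrow> 'a set.
           X = (\<Union>i\<le>k. Y i) \<and>
           (\<forall>i\<le>k. scale_dim_at_most_pred X d (r i) (Y i)
                    (if i = 0 then \<alpha> 0 0 else \<alpha> i (r (i - 1))))))"

definition asymptotic_property_D :: "'a set \<Rightarrow> ('a \<Rightarrow> 'a \<Rightarrow> ennreal) \<Rightarrow> bool" where
  "asymptotic_property_D X d \<longleftrightarrow> (\<exists>k \<alpha>. APD_profile X d k \<alpha>)"

definition asymptotic_property_C :: "'a set \<Rightarrow> ('a \<Rightarrow> 'a \<Rightarrow> ennreal) \<Rightarrow> bool" where
  "asymptotic_property_C X d \<longleftrightarrow>
     (\<forall>r :: nat \<Rightarrow> real. (\<forall>i\<ge>1. 0 < r i) \<longrightarrow>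
        (\<exists>n. \<exists>Y :: nat \<Rightarrow> 'a set.
           X = (\<Union>i\<in>{1..n}. Y i) \<and> (\<forall>i\<in>{1..n}. scale_dim_zero X d (r i) (Y i))))"

end

theory Submission
  imports Defs
begin

text \<open>
  Feed the profile the radii obtained recursively: the number of pieces of the \<open>i\<close>-th
  subset depends only on the radius of index \<open>i - 1\<close>, so the \<open>i\<close>-th radius can be chosen at
  least as large as all the given \<open>r j\<close> up to the total number of pieces used so far,
  including those of the \<open>i\<close>-th subset. Scale-dimension 0 passes to smaller scales, so the
  pieces, listed consecutively, form the required decomposition.
\<close>

text \<open>Enlarging the balls preserves their intersections, so a chain at scale \<open>s\<close>
  is also one at scale \<open>t\<close>.\<close>

lemma scale_component_mono:
  assumes "s \<le> t"
  shows "scale_component X d s A x \<subseteq> scale_component X d t A x"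
proof -
  have "pball X d y s \<subseteq> pball X d y t" for y
    unfolding pball_def using ennreal_leI[OF assms] by (auto intro: less_le_trans)
  then have "scale_chain X d t A xs" if "scale_chain X d s A xs" for xs
    using that unfolding scale_chain_def by blast
  then show ?thesis
    unfolding scale_component_def by blast
qed

lemma scale_dim_zero_antimono:
  assumes "s \<le> t" and "scale_dim_zero X d t A"
  shows "scale_dim_zero X d s A"
proof -
  have "pdiam d (scale_component X d s A x) \<le> pdiam d (scale_component X d t A x)" for x
    unfolding pdiam_def by (intro SUP_subset_mono scale_component_mono assms(1) order_refl)
  then have "(SUP x\<in>A. pdiam d (scale_component X d s A x))
      \<le> (SUP x\<in>A. pdiam d (scale_component X d t A x))"
    by (intro SUP_mono) blast
  with assms(2) show ?thesis
    unfolding scale_dim_zero_def by (rule le_less_trans[rotated])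
qed

text \<open>The decomposition demanded by Property C, relativized to a subset and with
  \<open>n\<close> explicit, so that it can be carried through an induction.\<close>

definition scale_decomposable ::
    "'a set \<Rightarrow> ('a \<Rightarrow> 'a \<Rightarrow> ennreal) \<Rightarrow> (nat \<Rightarrow> real) \<Rightarrow> nat \<Rightarrow> 'a set \<Rightarrow> bool" where
  "scale_decomposable X d r n A \<longleftrightarrow>
     (\<exists>Z :: nat \<Rightarrow> 'a set. A = (\<Union>i\<in>{1..n}. Z i) \<and> (\<forall>i\<in>{1..n}. scale_dim_zero X d (r i) (Z i)))"

lemma scale_decomposable_empty: "scale_decomposable X d r 0 {}"
  by (simp add: scale_decomposable_def)

text \<open>The pieces of \<open>B\<close> are appended to those of \<open>A\<close>. They take the
  indices after \<open>n\<close>, so \<open>s\<close> has to dominate \<open>r\<close> only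
  there.\<close>

lemma scale_decomposable_Un:
  assumes A: "scale_decomposable X d r n A"
    and B: "scale_dim_at_most_pred X d s B t"
    and s: "\<And>i. i \<in> {n<..n + nat \<lfloor>t\<rfloor>} \<Longrightarrow> r i \<le> s"
  shows "scale_decomposable X d r (n + nat \<lfloor>t\<rfloor>) (A \<union> B)"
proof -
  define l where "l = nat \<lfloor>t\<rfloor>"
  from A obtain Z where Z: "A = (\<Union>i\<in>{1..n}. Z i)" "\<forall>i\<in>{1..n}. scale_dim_zero X d (r i) (Z i)"
    unfolding scale_decomposable_def by blast
  from B obtain F where F: "B = (\<Union>j<l. F j)" "\<forall>j<l. scale_dim_zero X d s (F j)"
    unfolding scale_dim_at_most_pred_def l_def by blast
  \<comment> \<open>\<open>F\<close> is indexed from 0, and its first piece receives the index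
    \<open>Suc n\<close>.\<close>
  define W where "W i = (if i \<le> n then Z i else F (i - Suc n))" for i
  have "{1..n + l} = {1..n} \<union> (\<lambda>j. j + Suc n) ` {..<l}"
    unfolding lessThan_atLeast0 image_add_atLeastLessThan' by auto
  then have "(\<Union>i\<in>{1..n + l}. W i) = (\<Union>i\<in>{1..n}. W i) \<union> (\<Union>j<l. W (j + Suc n))"
    by (simp add: UN_Un)
  then have "(\<Union>i\<in>{1..n + l}. W i) = A \<union> B"
    unfolding Z(1) F(1) by (simp add: W_def)
  moreover have "scale_dim_zero X d (r i) (W i)" if i: "i \<in> {1..n + l}" for i
  proof (cases "i \<le> n")
    case True
    with i Z(2) show ?thesis by (simp add: W_def)
  next
    case False
    with i have "i - Suc n < l" and "r i \<le> s"
      using s[of i] by (auto simp: l_def)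
    with F(2) False show ?thesis
      by (auto simp: W_def intro: scale_dim_zero_antimono)
  qed
  ultimately show ?thesis
    unfolding scale_decomposable_def l_def by metis
qed

text \<open>Here \<open>R\<close> turns a number of pieces into a radius. The recursion is not
  circular: the increment at \<open>Suc i\<close> needs only the radius of index \<open>i\<close>,
  which the previous count determines.\<close>

fun piece_count :: "(nat \<Rightarrow> real \<Rightarrow> real) \<Rightarrow> (nat \<Rightarrow> real) \<Rightarrow> nat \<Rightarrow> nat" where
  "piece_count \<alpha> R 0 = nat \<lfloor>\<alpha> 0 0\<rfloor>"
| "piece_count \<alpha> R (Suc i) = piece_count \<alpha> R i + nat \<lfloor>\<alpha> (Suc i) (R (piece_count \<alpha> R i))\<rfloor>"

theorem proposition5p14:
  fixes X :: "'a set" and d :: "'a \<Rightarrow> 'a \<Rightarrow> ennreal"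
  assumes "inf_pseudo_metric_space X d"
    and "asymptotic_property_D X d"
  shows "asymptotic_property_C X d"
  unfolding asymptotic_property_C_def
proof (intro allI impI)
  fix r :: "nat \<Rightarrow> real"
  assume r: "\<forall>i\<ge>1. 0 < r i"
  obtain k \<alpha> where prof: "APD_profile X d k \<alpha>"
    using assms(2) unfolding asymptotic_property_D_def by blast
  \<comment> \<open>A sum of positive terms dominates each of them and grows with \<open>n\<close>;
    the summand 1 keeps \<open>R 0\<close> positive. The term \<open>r 0\<close> is left out, as its
    sign is unknown.\<close>
  define R where "R n = 1 + (\<Sum>i\<in>{1..n}. r i)" for n
  define N where "N = piece_count \<alpha> R"
  have r_nonneg: "0 \<le> r i" if "i \<in> {1..n}" for i n
    using r that by (simp add: less_imp_le)
  have R_pos: "0 < R n" for n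
    unfolding R_def using sum_nonneg[of "{1..n}" r] r_nonneg by fastforce
  have R_mono: "R m \<le> R n" if "m \<le> n" for m n
    unfolding R_def using that r_nonneg by (intro add_left_mono sum_mono2) auto
  have R_ge: "r i \<le> R n" if "i \<in> {1..n}" for i n
    unfolding R_def using member_le_sum[OF that, of r] r_nonneg by fastforce
  have "mono N"
    unfolding mono_iff_le_Suc N_def by simp
  then have "mono_on {..k} (\<lambda>i. R (N i))"
    by (intro mono_onI R_mono) (auto dest: monoD)
  then obtain Y where XY: "X = (\<Union>i\<le>k. Y i)" and Y: "\<forall>i\<le>k. scale_dim_at_most_pred X d (R (N i)) (Y i)
      (if i = 0 then \<alpha> 0 0 else \<alpha> i (R (N (i - 1))))"
    using prof R_pos unfolding APD_profile_def by (metis (no_types, lifting))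
  \<comment> \<open>The new pieces have indices at most \<open>N i\<close>, so \<open>R_ge\<close>
    bounds the given radii there by \<open>R (N i)\<close>, the scale at which the profile supplies
    \<open>Y i\<close>.\<close>
  have "scale_decomposable X d r (N i) (\<Union>j\<le>i. Y j)" if "i \<le> k" for i
    using that
  proof (induction i)
    case 0
    have "scale_dim_at_most_pred X d (R (N 0)) (Y 0) (\<alpha> 0 0)"
      using Y by fastforce
    from scale_decomposable_Un[OF scale_decomposable_empty this, of r] show ?case
      using R_ge by (simp add: N_def)
  next
    case (Suc i)
    have "scale_dim_at_most_pred X d (R (N (Suc i))) (Y (Suc i)) (\<alpha> (Suc i) (R (N i)))"
      using Y Suc.prems by fastforce
    moreover have "scale_decomposable X d r (N i) (\<Union>j\<le>i. Y j)"
      using Suc by simp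
    moreover have "N (Suc i) = N i + nat \<lfloor>\<alpha> (Suc i) (R (N i))\<rfloor>"
      by (simp add: N_def)
    ultimately show ?case
      using scale_decomposable_Un[of X d r "N i" "\<Union>j\<le>i. Y j" "R (N (Suc i))"] R_ge
      by (simp add: atMost_Suc Un_commute)
  qed
  then have "scale_decomposable X d r (N k) X"
    unfolding XY by simp
  then show "\<exists>n. \<exists>Y :: nat \<Rightarrow> 'a set.
      X = (\<Union>i\<in>{1..n}. Y i) \<and> (\<forall>i\<in>{1..n}. scale_dim_zero X d (r i) (Y i))"
    unfolding scale_decomposable_def by blast
qed

end
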